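(* Let $q>0$. For all initial states $(\rho^l,v^l),(\rho^r,v^r)\in\mathcal D$, let $\tilde\rho_1$ and $\tilde\rho_2$ denote the $\rho$-components of $\mathcal{RS}^q_1((\rho^l,v^l),(\rho^r,v^r))$ and $\mathcal{RS}^q_2((\rho^l,v^l),(\rho^r,v^r))$ respectively. Then $$\mathrm{Tot.Var.}(\tilde\rho_1)\ \ge\ \mathrm{Tot.Var.}(\tilde\rho_2),$$ where $\mathrm{Tot.Var.}$ is the total variation over $x\in\mathbb R$.
   Context: Pressure. $p\in C^2([0,+\infty);[0,+\infty))$ satisfies $p(0)=0$, $p'(\rho)>0$ for all $\rho>0$, and $\rho\mapsto\rho p(\rho)$ is strictly convex. System. $\mathcal D=\mathbb R^+\times\mathbb R^+$ with $\mathbb R^+=[0,+\infty)$; states are $(\rho,v)\in\mathcal D$. The Aw-Rascle system is $\partial_t\rho+\partial_x(\rho v)=0$, $\partial_t(\rho(v+p(\rho)))+\partial_x(\rho v(v+p(\rho)))=0$. Write $f_1(\rho,v)=\rho v$ and $\lambda_1(\rho,v)=v-\rho p'(\rho)$. Classical Riemann solver. For $(\rho^l,v^l),(\rho^r,v^r)\in\mathcal D$, $\mathcal{RS}((\rho^l,v^l),(\rho^r,v^r))$ is the function of $x\in\mathbb R$ (the unconstrained self-similar solution at time $t=1$ with left/right initial states separated at $x=0$) defined a.e. as follows, with $w^l=v^l+p(\rho^l)$. Let $I_2=\{\rho\ge0:\ v^l+p(\rho^l)-p(\rho)=v^r\}$; the intermediate state in cases (a) and (b) is $(\rho^m,v^m)$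 with $\rho^m=\max I_2$, $v^m=v^r$. (a) If $v^r\le v^l$: it equals $(\rho^l,v^l)$ for $x<\sigma$, $(\rho^m,v^m)$ for $\sigma<x<v^r$, $(\rho^r,v^r)$ for $x>v^r$, where $\sigma=(\rho^mv^m-\rho^lv^l)/(\rho^m-\rho^l)$ if $\rho^m\ne\rho^l$; if $\rho^m=\rho^l$ it equals $(\rho^l,v^l)$ for $x<v^r$ and $(\rho^r,v^r)$ for $x>v^r$. (b) If $v^l<v^r\le w^l$: it equals $(\rho^l,v^l)$ for $x<\lambda_1(\rho^l,v^l)$; for $\lambda_1(\rho^l,v^l)\le x\le\lambda_1(\rho^m,v^m)$ it is the unique state $(\rho,\,w^l-p(\rho))$ with $\rho^m\le\rho\le\rho^l$ and $\lambda_1(\rho,w^l-p(\rho))=x$; $(\rho^m,v^m)$ for $\lambda_1(\rho^m,v^m)<x<v^r$; $(\rho^r,v^r)$ for $x>v^r$. (c) If $v^r>w^l$ (vacuum): it equals $(\rho^l,v^l)$ for $x<\lambda_1(\rho^l,v^l)$; for $\lambda_1(\rho^l,v^l)\le x\le w^l$ it is the state $(\rho,w^l-p(\rho))$ with $0\le\rho\le\rho^l$ and $\lambda_1=x$; $(0,x)$ for $w^l<x<v^r$; $(\rho^r,v^r)$ for $x>v^r$. $f_1(\mathcal{RS}(\cdot,\cdot)(0))$ denotes the common value of $f_1$ at the one-sided traces at $x=0$. Constrained solvers. Given $q>0$, let $I_1=\{\rho\ge0:\ \rho\,(v^l+p(\rho^l)-p(\rho))=q\}$ and, when $I_1\neq\emptyset$,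 $\hat\rho=\max I_1$, $\hat v=q/\hat\rho$, $\check\rho_1=\min I_1$, $\check v_1=q/\check\rho_1$. Let also $\check v_2=v^r$, $\check\rho_2=q/v^r$ (when $v^r>0$, which always holds when these are used below). For $i\in\{1,2\}$: if $f_1(\mathcal{RS}((\rho^l,v^l),(\rho^r,v^r))(0))\le q$, then $\mathcal{RS}^q_i((\rho^l,v^l),(\rho^r,v^r))=\mathcal{RS}((\rho^l,v^l),(\rho^r,v^r))$; otherwise $\mathcal{RS}^q_i((\rho^l,v^l),(\rho^r,v^r))(x)$ equals $\mathcal{RS}((\rho^l,v^l),(\hat\rho,\hat v))(x)$ for $x<0$ and $\mathcal{RS}((\check\rho_i,\check v_i),(\rho^r,v^r))(x)$ for $x>0$. Functions of $x$ are considered up to a.e. equality; the total variation is the essential one (that of a good representative).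
   Formalization: Adds the assumption that I_2 is nonempty when v^r ≤ v^l + p(ρ^l), i.e. that the classical Riemann solution is defined; for a bounded pressure such as p(ρ)=ρ/(1+ρ), max I_2 can otherwise be the maximum of the empty set. *)

theory Defs
  imports "HOL-Analysis.Analysis"
begin

definition strictly_convex_on :: "real set \<Rightarrow> (real \<Rightarrow> real) \<Rightarrow> bool" where
  "strictly_convex_on S f \<longleftrightarrow> convex S \<and>
     (\<forall>x\<in>S. \<forall>y\<in>S. \<forall>t\<in>{0<..<1}. x \<noteq> y \<longrightarrow>
        f ((1 - t) * x + t * y) < (1 - t) * f x + t * f y)"

text \<open>
  A pressure is a total function of which only the values on \<open>[0, \<infinity>)\<close> matter; its derivatives
  at \<open>0\<close> are one-sided.
\<close>

definition is_pressure :: "(real \<Rightarrow> real) \<Rightarrow> bool" where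
  "is_pressure p \<longleftrightarrow>
     (\<exists>p' p''.
        (\<forall>\<rho>\<ge>0. (p has_real_derivative p' \<rho>) (at \<rho> within {0..})) \<and>
        (\<forall>\<rho>\<ge>0. (p' has_real_derivative p'' \<rho>) (at \<rho> within {0..})) \<and>
        continuous_on {0..} p'' \<and>
        (\<forall>\<rho>>0. p' \<rho> > 0)) \<and>
     (\<forall>\<rho>\<ge>0. p \<rho> \<ge> 0) \<and>
     p 0 = 0 \<and>
     strictly_convex_on {0..} (\<lambda>\<rho>. \<rho> * p \<rho>)"

type_synonym state = "real \<times> real"

definition states :: "state set" where
  "states = {0..} \<times> {0..}"

definition flux :: "state \<Rightarrow> real" where
  "flux = (\<lambda>(\<rho>, v). \<rho> * v)"

text \<open>
  At \<open>\<rho> = 0\<close> the two-sided \<open>deriv\<close> has no meaning, but it is multiplied by \<open>0\<close>.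
\<close>

definition lambda1 :: "(real \<Rightarrow> real) \<Rightarrow> state \<Rightarrow> real" where
  "lambda1 p = (\<lambda>(\<rho>, v). v - \<rho> * deriv p \<rho>)"

definition I2 :: "(real \<Rightarrow> real) \<Rightarrow> state \<Rightarrow> state \<Rightarrow> real set" where
  "I2 p = (\<lambda>(\<rho>l, vl) (\<rho>r, vr). {\<rho>. \<rho> \<ge> 0 \<and> vl + p \<rho>l - p \<rho> = vr})"

definition rarefaction_state :: "(real \<Rightarrow> real) \<Rightarrow> real \<Rightarrow> real \<Rightarrow> real \<Rightarrow> real \<Rightarrow> state" where
  "rarefaction_state p w a b x =
     (THE u. \<exists>\<rho>. a \<le> \<rho> \<and> \<rho> \<le> b \<and> u = (\<rho>, w - p \<rho>) \<and> lambda1 p u = x)"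

text \<open>
  The classical solution is determined up to a null set only; at the points where the wave
  description leaves the value open, an arbitrary choice is made. The three branches are shock
  (or no first wave) plus contact, rarefaction plus contact, and vacuum.
\<close>

definition RS :: "(real \<Rightarrow> real) \<Rightarrow> state \<Rightarrow> state \<Rightarrow> real \<Rightarrow> state" where
  "RS p = (\<lambda>(\<rho>l, vl) (\<rho>r, vr) x.
     let w = vl + p \<rho>l;
         \<rho>m = (GREATEST \<rho>. \<rho> \<in> I2 p (\<rho>l, vl) (\<rho>r, vr));
         vm = vr
     in
       if vr \<le> vl then
         if \<rho>m = \<rho>l then
           if x < vr then (\<rho>l, vl) else (\<rho>r, vr)
         else
           let \<sigma> = (\<rho>m * vm - \<rho>l * vl) / (\<rho>m - \<rho>l) in
             if x < \<sigma> then (\<rho>l, vl)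
             else if x < vr then (\<rho>m, vm)
             else (\<rho>r, vr)
       else if vr \<le> w then
         if x < lambda1 p (\<rho>l, vl) then (\<rho>l, vl)
         else if x \<le> lambda1 p (\<rho>m, vm) then rarefaction_state p w \<rho>m \<rho>l x
         else if x < vr then (\<rho>m, vm)
         else (\<rho>r, vr)
       else
         if x < lambda1 p (\<rho>l, vl) then (\<rho>l, vl)
         else if x \<le> w then rarefaction_state p w 0 \<rho>l x
         else if x < vr then (0, x)
         else (\<rho>r, vr))"

text \<open>
  The intermediate state \<open>max I2\<close> is used exactly when \<open>vr \<le> vl + p \<rho>l\<close>. The properties of a
  pressure do not force \<open>I2\<close> to be nonempty then: \<open>p \<rho> = \<rho> / (1 + \<rho>)\<close> is a bounded pressure, and
  \<open>I2\<close> is empty once \<open>vl + p \<rho>l - vr \<ge> 1\<close>. The following condition says that the classical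
  solution exists; it holds for all data in \<open>states\<close> if \<open>p\<close> is unbounded.
\<close>

definition RS_defined :: "(real \<Rightarrow> real) \<Rightarrow> state \<Rightarrow> state \<Rightarrow> bool" where
  "RS_defined p = (\<lambda>(\<rho>l, vl) (\<rho>r, vr).
     vr \<le> vl + p \<rho>l \<longrightarrow> I2 p (\<rho>l, vl) (\<rho>r, vr) \<noteq> {})"

definition flux_at_0 :: "(real \<Rightarrow> state) \<Rightarrow> real" where
  "flux_at_0 u =
     (THE y. \<exists>um up. (u \<longlongrightarrow> um) (at_left 0) \<and> (u \<longlongrightarrow> up) (at_right 0) \<and>
        flux um = y \<and> flux up = y)"

definition I1 :: "(real \<Rightarrow> real) \<Rightarrow> real \<Rightarrow> state \<Rightarrow> real set" where
  "I1 p q = (\<lambda>(\<rho>l, vl). {\<rho>. \<rho> \<ge> 0 \<and> \<rho> * (vl + p \<rho>l - p \<rho>) = q})"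

definition hat_state :: "(real \<Rightarrow> real) \<Rightarrow> real \<Rightarrow> state \<Rightarrow> state" where
  "hat_state p q l = (let \<rho> = (GREATEST \<rho>. \<rho> \<in> I1 p q l) in (\<rho>, q / \<rho>))"

definition check_state1 :: "(real \<Rightarrow> real) \<Rightarrow> real \<Rightarrow> state \<Rightarrow> state" where
  "check_state1 p q l = (let \<rho> = (LEAST \<rho>. \<rho> \<in> I1 p q l) in (\<rho>, q / \<rho>))"

definition check_state2 :: "real \<Rightarrow> state \<Rightarrow> state" where
  "check_state2 q r = (q / snd r, snd r)"

definition constrained_RS ::
  "(real \<Rightarrow> real) \<Rightarrow> real \<Rightarrow> state \<Rightarrow> state \<Rightarrow> state \<Rightarrow> real \<Rightarrow> state" where
  "constrained_RS p q c l r =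
     (if flux_at_0 (RS p l r) \<le> q then RS p l r
      else (\<lambda>x. if x < 0 then RS p l (hat_state p q l) x else RS p c r x))"

definition RS1 :: "(real \<Rightarrow> real) \<Rightarrow> real \<Rightarrow> state \<Rightarrow> state \<Rightarrow> real \<Rightarrow> state" where
  "RS1 p q l r = constrained_RS p q (check_state1 p q l) l r"

definition RS2 :: "(real \<Rightarrow> real) \<Rightarrow> real \<Rightarrow> state \<Rightarrow> state \<Rightarrow> real \<Rightarrow> state" where
  "RS2 p q l r = constrained_RS p q (check_state2 q r) l r"

definition variation :: "(real \<Rightarrow> real) \<Rightarrow> ennreal" where
  "variation f =
     (SUP (n, t) \<in> {(n, t :: nat \<Rightarrow> real). mono t}.
        \<Sum>i<n. ennreal \<bar>f (t (Suc i)) - f (t i)\<bar>)"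

definition tot_var :: "(real \<Rightarrow> real) \<Rightarrow> ennreal" where
  "tot_var f = (INF g \<in> {g. AE x in lborel. g x = f x}. variation g)"

end

theory Submission imports Defs
begin

text \<open>
  Nothing has to be shown when the flux of the classical solution at \<open>0\<close> is at most \<open>q\<close>.
  Otherwise the two constrained solutions agree for \<open>x < 0\<close>. The second one is then as simple as
  possible on the right: it takes the density \<open>c = q / vr\<close> up to \<open>x = vr\<close> and \<open>\<rho>r\<close> afterwards. The
  first one starts on the right from \<open>\<rho>1 = min I1\<close>, moves by a wave of the first family to an
  intermediate density (or to the vacuum), and then jumps to \<open>\<rho>r\<close> at \<open>x = vr\<close>, too.

  Along the curve \<open>v = w - p \<rho>\<close> the flux \<open>G \<rho> = \<rho> * (w - p \<rho>)\<close> is strictly concave and its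
  derivative is the first characteristic speed, so waves of the first family are those of a scalar
  conservation law with flux \<open>G\<close>. Both \<open>c\<close> and the intermediate density \<open>\<rho>m\<close> belong to
  the velocity \<open>vr\<close>, and \<open>c\<close> and \<open>\<rho>1\<close> belong to the flux \<open>q\<close>; comparing velocities and fluxes
  places \<open>c\<close> between \<open>\<rho>1\<close> and \<open>\<rho>m\<close> (or between \<open>\<rho>1\<close> and \<open>0\<close>, if there is a vacuum). The assumption
  that the classical flux at \<open>0\<close> exceeds \<open>q\<close> rules out that the wave from \<open>\<rho>1\<close> to \<open>\<rho>m\<close> has
  negative speed (\<open>trace_flux\<close>). Hence the first solution takes, on open subintervals of
  \<open>(0, vr)\<close>, values \<open>\<ge> c\<close> and values \<open>\<le> c\<close> (\<open>RS1_straddles_check_density\<close>).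

  This suffices (\<open>tot_var_le_if_intermediate_plateau\<close>): replacing a function on an interval by a
  constant between two of its values there cannot increase the variation. The part on \<open>x < 0\<close>,
  with its trace at \<open>0\<close>, never has to be computed.
\<close>

section \<open>Total variation\<close>

lemma AE_lborel_witness_in_interval:
  fixes a b :: real
  assumes "AE x in lborel. P x" and "a < b"
  obtains x where "a < x" "x < b" "P x"
proof (rule ccontr)
  assume "\<not> thesis"
  with that have "AE x in lborel. x \<notin> {a<..<b}"
    using assms(1) by (auto elim!: eventually_mono)
  hence "emeasure lborel {a<..<b} = 0"
    by (subst (asm) AE_iff_measurable[of "{a<..<b}"]) auto
  thus False using \<open>a < b\<close> by simp
qed

lemma variation_comp_mono_le:
  assumes "mono \<phi>"
  shows "variation (f \<circ> \<phi>) \<le> variation f"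
  unfolding variation_def
proof (rule SUP_least, clarify)
  fix n and t :: "nat \<Rightarrow> real"
  assume "mono t"
  hence "mono (\<phi> \<circ> t)" using assms by (auto simp: mono_def)
  thus "(\<Sum>i<n. ennreal \<bar>(f \<circ> \<phi>) (t (Suc i)) - (f \<circ> \<phi>) (t i)\<bar>)
      \<le> (SUP (n, t)\<in>{(n, t :: nat \<Rightarrow> real). mono t}. \<Sum>i<n. ennreal \<bar>f (t (Suc i)) - f (t i)\<bar>)"
    by (intro SUP_upper2[where i = "(n, \<phi> \<circ> t)"]) auto
qed

text \<open>
  The variation is a convex functional. This is what allows for plateau values that a jump skips:
  such a value is a convex combination of two values that are attained.
\<close>

lemma variation_convex_combination_le:
  assumes "0 \<le> s" "s \<le> 1" "variation f \<le> V" "variation g \<le> V"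
  shows "variation (\<lambda>x. (1 - s) * f x + s * g x) \<le> V"
  unfolding variation_def
proof (rule SUP_least, clarify)
  fix n and t :: "nat \<Rightarrow> real"
  assume "mono t"
  have sum_le: "(\<Sum>i<n. ennreal \<bar>h (t (Suc i)) - h (t i)\<bar>) \<le> V" if "variation h \<le> V" for h
  proof -
    have "(\<Sum>i<n. ennreal \<bar>h (t (Suc i)) - h (t i)\<bar>) \<le> variation h"
      unfolding variation_def using \<open>mono t\<close> by (intro SUP_upper2[where i = "(n, t)"]) auto
    thus ?thesis using that by (rule order_trans)
  qed
  have "(\<Sum>i<n. ennreal \<bar>(1 - s) * f (t (Suc i)) + s * g (t (Suc i)) - ((1 - s) * f (t i) + s * g (t i))\<bar>)
     \<le> (\<Sum>i<n. ennreal (1 - s) * ennreal \<bar>f (t (Suc i)) - f (t i)\<bar>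
            + ennreal s * ennreal \<bar>g (t (Suc i)) - g (t i)\<bar>)"
  proof (rule sum_mono)
    fix i
    let ?a = "f (t (Suc i)) - f (t i)" and ?b = "g (t (Suc i)) - g (t i)"
    have "\<bar>(1 - s) * f (t (Suc i)) + s * g (t (Suc i)) - ((1 - s) * f (t i) + s * g (t i))\<bar>
        = \<bar>(1 - s) * ?a + s * ?b\<bar>"
      by (simp add: algebra_simps)
    also have "\<dots> \<le> (1 - s) * \<bar>?a\<bar> + s * \<bar>?b\<bar>"
      using abs_triangle_ineq[of "(1 - s) * ?a" "s * ?b"] assms by (simp add: abs_mult)
    finally show "ennreal \<bar>(1 - s) * f (t (Suc i)) + s * g (t (Suc i)) - ((1 - s) * f (t i) + s * g (t i))\<bar>
        \<le> ennreal (1 - s) * ennreal \<bar>?a\<bar> + ennreal s * ennreal \<bar>?b\<bar>"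
      using assms by (simp add: ennreal_mult[symmetric] ennreal_plus[symmetric] ennreal_leI
          del: ennreal_plus)
  qed
  also have "\<dots> = ennreal (1 - s) * (\<Sum>i<n. ennreal \<bar>f (t (Suc i)) - f (t i)\<bar>)
      + ennreal s * (\<Sum>i<n. ennreal \<bar>g (t (Suc i)) - g (t i)\<bar>)"
    by (simp add: sum.distrib sum_distrib_left del: sum_ennreal)
  also have "\<dots> \<le> ennreal (1 - s) * V + ennreal s * V"
    by (intro add_mono mult_left_mono sum_le assms) auto
  also have "\<dots> = (ennreal (1 - s) + ennreal s) * V" by (simp add: distrib_right)
  also have "\<dots> = V" using assms by (simp add: ennreal_plus[symmetric] del: ennreal_plus)
  finally show "(\<Sum>i<n. ennreal \<bar>(1 - s) * f (t (Suc i)) + s * g (t (Suc i)) - ((1 - s) * f (t i) + s * g (t i))\<bar>) \<le> V" .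
qed

text \<open>
  Freezing the argument on \<open>[0, b)\<close> at a point \<open>y\<close> is a monotone change of variable, so it does not
  increase the variation. Doing this for two points whose values enclose \<open>c\<close>, and combining the
  results convexly, produces the plateau \<open>c\<close>. The enclosing values are required on intervals, since
  a representative of \<open>u1\<close> agrees with \<open>u1\<close> almost everywhere only.
\<close>

lemma tot_var_le_if_intermediate_plateau:
  fixes u1 u2 :: "real \<Rightarrow> real"
  assumes neg: "\<And>x. x < 0 \<Longrightarrow> u1 x = u2 x"
    and plateau: "\<And>x. 0 \<le> x \<Longrightarrow> x < b \<Longrightarrow> u2 x = c"
    and last: "\<And>x. b \<le> x \<Longrightarrow> u2 x = r" "\<And>x. b < x \<Longrightarrow> u1 x = r"
    and above: "0 \<le> a1" "a1 < b1" "b1 \<le> b" "\<And>x. a1 < x \<Longrightarrow> x < b1 \<Longrightarrow> c \<le> u1 x"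
    and below: "0 \<le> a2" "a2 < b2" "b2 \<le> b" "\<And>x. a2 < x \<Longrightarrow> x < b2 \<Longrightarrow> u1 x \<le> c"
  shows "tot_var u2 \<le> tot_var u1"
  unfolding tot_var_def
proof (rule INF_greatest, clarify)
  fix g1 assume g1: "AE x in lborel. g1 x = u1 x"
  obtain y1 where y1: "a1 < y1" "y1 < b1" "g1 y1 = u1 y1"
    using AE_lborel_witness_in_interval[OF g1 above(2)] .
  obtain y2 where y2: "a2 < y2" "y2 < b2" "g1 y2 = u1 y2"
    using AE_lborel_witness_in_interval[OF g1 below(2)] .
  obtain z where z: "b < z" "z < b + 1" "g1 z = u1 z"
    by (rule AE_lborel_witness_in_interval[OF g1, of b "b + 1"]) auto
  have "g1 y2 \<le> c" "c \<le> g1 y1" using y1 y2 above(4) below(4) by auto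
  hence "c \<in> closed_segment (g1 y2) (g1 y1)" by (simp add: closed_segment_eq_real_ivl)
  then obtain s where s: "0 \<le> s" "s \<le> 1" "c = (1 - s) * g1 y2 + s * g1 y1"
    by (auto simp: closed_segment_def)
  \<comment> \<open>\<open>z\<close> replaces the whole half-line beyond \<open>b\<close>, where \<open>g1\<close> may differ from \<open>r\<close> on a null set.\<close>
  define \<phi> where "\<phi> y x = (if x < 0 then x else if x < b then y else z)" for y x :: real
  have mono: "mono (\<phi> y)" if "0 \<le> y" "y \<le> z" for y
    unfolding mono_def \<phi>_def using that by auto
  define g2 where "g2 x = (1 - s) * (g1 \<circ> \<phi> y2) x + s * (g1 \<circ> \<phi> y1) x" for x
  have "variation g2 \<le> variation g1"
    unfolding g2_def using s y1 y2 z above below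
    by (intro variation_convex_combination_le variation_comp_mono_le mono) auto
  moreover have "AE x in lborel. g2 x = u2 x"
    using g1
  proof (eventually_elim)
    case (elim x)
    have "g1 z = r" using z last by simp
    thus ?case using elim neg[of x] plateau[of x] last(1)[of x] s(3)
      by (auto simp: g2_def \<phi>_def algebra_simps)
  qed
  ultimately show "(INF g\<in>{g. AE x in lborel. g x = u2 x}. variation g) \<le> variation g1"
    by (intro INF_lower2[of g2]) auto
qed

section \<open>The flux at the constraint\<close>

lemma flux_at_0_eq:
  assumes "(u \<longlongrightarrow> um) (at_left 0)" "(u \<longlongrightarrow> up) (at_right 0)" "flux um = y" "flux up = y"
  shows "flux_at_0 u = y"
  unfolding flux_at_0_def
proof (rule the_equality)
  show "\<exists>um up. (u \<longlongrightarrow> um) (at_left 0) \<and> (u \<longlongrightarrow> up) (at_right 0) \<and> flux um = y \<and> flux up = y"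
    using assms by blast
next
  fix y' assume "\<exists>um up. (u \<longlongrightarrow> um) (at_left 0) \<and> (u \<longlongrightarrow> up) (at_right 0) \<and> flux um = y' \<and> flux up = y'"
  thus "y' = y" using assms tendsto_unique[OF trivial_limit_at_left_real] by blast
qed

lemma flux_at_0_jump:
  assumes "a < 0" "0 < b" "\<And>x. a < x \<Longrightarrow> x < 0 \<Longrightarrow> u x = um"
    "\<And>x. 0 < x \<Longrightarrow> x < b \<Longrightarrow> u x = up" "flux um = flux up"
  shows "flux_at_0 u = flux um"
proof (rule flux_at_0_eq)
  show "(u \<longlongrightarrow> um) (at_left 0)"
    using assms by (intro tendsto_eventually) (auto simp: eventually_at_left[of a])
  show "(u \<longlongrightarrow> up) (at_right 0)"
    using assms by (intro tendsto_eventually) (auto simp: eventually_at_right[of _ b])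
qed (use assms in auto)

lemma flux_at_0_continuous:
  assumes "0 < b" "\<And>x. x < b \<Longrightarrow> u x = h x" "isCont h 0"
  shows "flux_at_0 u = flux (h 0)"
proof (rule flux_at_0_eq)
  have h: "(h \<longlongrightarrow> h 0) (at_left 0)" "(h \<longlongrightarrow> h 0) (at_right 0)"
    using assms(3) by (auto simp: isCont_def filterlim_at_split)
  show "(u \<longlongrightarrow> h 0) (at_left 0)"
    by (rule Lim_transform_eventually[OF h(1)])
       (use assms in \<open>auto simp: eventually_at_left[of "-1"] intro!: exI[of _ "-1"]\<close>)
  show "(u \<longlongrightarrow> h 0) (at_right 0)"
    by (rule Lim_transform_eventually[OF h(2)])
       (use assms in \<open>auto simp: eventually_at_right[of _ b]\<close>)
qed auto

section \<open>The flux along a curve of the first family\<close>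

text \<open>
  The data of a pressure with a chosen one-sided derivative \<open>p'\<close>, which avoids \<open>deriv p 0\<close>.
\<close>

locale pressure =
  fixes p p' :: "real \<Rightarrow> real"
  assumes p_deriv: "\<And>\<rho>. \<rho> \<ge> 0 \<Longrightarrow> (p has_real_derivative p' \<rho>) (at \<rho> within {0..})"
    and p'_cont: "continuous_on {0..} p'"
    and p'_pos: "\<And>\<rho>. \<rho> > 0 \<Longrightarrow> p' \<rho> > 0"
    and p_0: "p 0 = 0"
    and convex: "strictly_convex_on {0..} (\<lambda>\<rho>. \<rho> * p \<rho>)"
begin

text \<open>
  The flux and the first characteristic speed at the state \<open>(\<rho>, w - p \<rho>)\<close>, which lies on the
  curve of the first family with Lagrangian marker \<open>w\<close>.
\<close>

definition curve_flux :: "real \<Rightarrow> real \<Rightarrow> real" where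
  "curve_flux w \<rho> = \<rho> * (w - p \<rho>)"

definition char_speed :: "real \<Rightarrow> real \<Rightarrow> real" where
  "char_speed w \<rho> = w - p \<rho> - \<rho> * p' \<rho>"

lemma p_cont: "continuous_on {0..} p"
  by (meson p_deriv DERIV_continuous_on atLeast_iff)

lemma p_strict_mono: "0 \<le> x \<Longrightarrow> x < y \<Longrightarrow> p x < p y"
proof (rule DERIV_pos_imp_increasing_open[of x y p])
  fix z assume "0 \<le> x" "x < z" "z < y"
  hence "z > 0" by simp
  hence "(p has_real_derivative p' z) (at z)"
    using p_deriv[of z] at_within_interior[of z "{0..}"] by (simp add: interior_real_atLeast)
  thus "\<exists>d. (p has_real_derivative d) (at z) \<and> d > 0" using p'_pos[OF \<open>z > 0\<close>] by blast
next
  assume "0 \<le> x"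
  thus "continuous_on {x..y} p" by (intro continuous_on_subset[OF p_cont]) auto
qed

lemma p_le_iff: "0 \<le> x \<Longrightarrow> 0 \<le> y \<Longrightarrow> p x \<le> p y \<longleftrightarrow> x \<le> y"
  using p_strict_mono[of x y] p_strict_mono[of y x] by (cases x y rule: linorder_cases) auto

lemma p_eq_iff: "0 \<le> x \<Longrightarrow> 0 \<le> y \<Longrightarrow> p x = p y \<longleftrightarrow> x = y"
  using p_le_iff[of x y] p_le_iff[of y x] by auto

lemma p_nonneg: "0 \<le> x \<Longrightarrow> 0 \<le> p x"
  using p_le_iff[of 0 x] p_0 by simp

lemma lambda1_curve:
  assumes "0 \<le> \<rho>"
  shows "lambda1 p (\<rho>, w - p \<rho>) = char_speed w \<rho>"
proof (cases "\<rho> = 0")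
  case False
  hence "(p has_real_derivative p' \<rho>) (at \<rho>)"
    using assms p_deriv[of \<rho>] at_within_interior[of \<rho> "{0..}"] by (simp add: interior_real_atLeast)
  thus ?thesis by (simp add: lambda1_def char_speed_def DERIV_imp_deriv)
qed (simp add: lambda1_def char_speed_def)

lemma char_speed_cont: "continuous_on {0..} (char_speed w)"
  unfolding char_speed_def by (intro continuous_intros p_cont p'_cont)

lemma char_speed_le: "0 \<le> \<rho> \<Longrightarrow> char_speed w \<rho> \<le> w - p \<rho>"
  using p'_pos[of \<rho>] by (cases "\<rho> = 0") (auto simp: char_speed_def)

lemma curve_flux_deriv:
  assumes "0 \<le> x"
  shows "(curve_flux w has_real_derivative char_speed w x) (at x within {0..})"
proof -
  have "((\<lambda>\<rho>. \<rho> * (w - p \<rho>)) has_real_derivative 1 * (w - p x) + (0 - p' x) * x) (at x within {0..})"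
    by (intro DERIV_mult DERIV_diff DERIV_const DERIV_ident p_deriv assms)
  thus ?thesis unfolding curve_flux_def[abs_def] char_speed_def by (simp add: mult.commute)
qed

lemma curve_flux_cont: "continuous_on {0..} (curve_flux w)"
  by (meson curve_flux_deriv DERIV_continuous_on atLeast_iff)

lemma curve_flux_strictly_concave:
  assumes "0 \<le> x" "0 \<le> y" "x \<noteq> y" "0 < t" "t < 1"
  shows "(1 - t) * curve_flux w x + t * curve_flux w y < curve_flux w ((1 - t) * x + t * y)"
proof -
  let ?z = "(1 - t) * x + t * y"
  have "?z * p ?z < (1 - t) * (x * p x) + t * (y * p y)"
    using convex assms unfolding strictly_convex_on_def by simp
  moreover have "?z * w = (1 - t) * (x * w) + t * (y * w)" by (simp add: algebra_simps)
  ultimately show ?thesis by (simp add: curve_flux_def right_diff_distrib)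
qed

text \<open>
  By concavity, the difference quotient at \<open>x\<close> in the parameter of the segment to \<open>y\<close> is at least the
  full increment; in the limit it becomes the directional derivative. Working along the segment treats the boundary point \<open>0\<close> like every other point.
\<close>

lemma curve_flux_below_tangent_weak:
  assumes "0 \<le> x" "0 \<le> y"
  shows "curve_flux w y \<le> curve_flux w x + char_speed w x * (y - x)"
proof (cases "x = y")
  case False
  let ?c = "\<lambda>t. x + t * (y - x)"
  have "?c ` {0..1} \<subseteq> {0..}"
  proof (rule image_subsetI)
    fix t :: real assume "t \<in> {0..1}"
    hence "0 \<le> (1 - t) * x + t * y" using assms by simp
    thus "?c t \<in> {0..}" by (simp add: algebra_simps)
  qed
  hence "(curve_flux w has_real_derivative char_speed w (?c 0)) (at (?c 0) within ?c ` {0..1})"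
    using DERIV_subset[OF curve_flux_deriv] assms by simp
  hence "((curve_flux w \<circ> ?c) has_real_derivative char_speed w (?c 0) * (y - x)) (at 0 within {0..1})"
    by (rule DERIV_image_chain) (auto intro!: derivative_eq_intros)
  hence lim: "((\<lambda>t. (curve_flux w (?c t) - curve_flux w x) / t) \<longlongrightarrow> char_speed w x * (y - x)) (at_right 0)"
    by (simp add: has_field_derivative_iff at_within_Icc_at_right)
  have "\<forall>\<^sub>F t in at_right 0. curve_flux w y - curve_flux w x \<le> (curve_flux w (?c t) - curve_flux w x) / t"
    unfolding eventually_at_right[of 0 "1::real", OF zero_less_one]
  proof (intro exI[of _ 1] conjI allI impI)
    fix t :: real assume t: "0 < t" "t < 1"
    have "(1 - t) * x + t * y = ?c t" by (simp add: algebra_simps)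
    hence "(1 - t) * curve_flux w x + t * curve_flux w y < curve_flux w (?c t)"
      using curve_flux_strictly_concave[OF assms False t] by simp
    thus "curve_flux w y - curve_flux w x \<le> (curve_flux w (?c t) - curve_flux w x) / t"
      using t by (simp add: field_simps)
  qed simp
  from tendsto_lowerbound[OF lim this] show ?thesis by simp
qed simp

text \<open>Strictness comes from the midpoint, which lies strictly above the chord.\<close>

lemma curve_flux_below_tangent:
  assumes "0 \<le> x" "0 \<le> y" "x \<noteq> y"
  shows "curve_flux w y < curve_flux w x + char_speed w x * (y - x)"
proof -
  have "1/2 * curve_flux w x + 1/2 * curve_flux w y < curve_flux w (1/2 * x + 1/2 * y)"
    using curve_flux_strictly_concave[OF assms, of "1/2"] by simp
  also have "\<dots> \<le> curve_flux w x + char_speed w x * (1/2 * x + 1/2 * y - x)"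
    using assms by (intro curve_flux_below_tangent_weak) auto
  finally show ?thesis by (simp add: algebra_simps)
qed

text \<open>Add the tangent inequalities at \<open>x\<close> and at \<open>y\<close>.\<close>

lemma char_speed_less:
  assumes "0 \<le> x" "x < y"
  shows "char_speed w y < char_speed w x"
proof -
  have "0 < (char_speed w x - char_speed w y) * (y - x)"
    using curve_flux_below_tangent[of x y w] curve_flux_below_tangent[of y x w] assms
    by (simp add: algebra_simps)
  thus ?thesis using assms by (simp add: zero_less_mult_iff)
qed

lemma char_speed_le_iff:
  "0 \<le> x \<Longrightarrow> 0 \<le> y \<Longrightarrow> char_speed w x \<le> char_speed w y \<longleftrightarrow> y \<le> x"
  using char_speed_less[of x y w] char_speed_less[of y x w] by (smt (verit))

lemma char_speed_eq_iff:
  "0 \<le> x \<Longrightarrow> 0 \<le> y \<Longrightarrow> char_speed w x = char_speed w y \<longleftrightarrow> x = y"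
  using char_speed_less[of x y w] char_speed_less[of y x w] by (smt (verit))

lemma curve_flux_gt_min:
  assumes "0 \<le> x" "x < y" "y < z"
  shows "min (curve_flux w x) (curve_flux w z) < curve_flux w y"
proof (cases "char_speed w y \<ge> 0")
  case True
  hence "char_speed w y * (x - y) \<le> 0" using assms by (simp add: mult_nonneg_nonpos)
  thus ?thesis using curve_flux_below_tangent[of y x w] assms by simp
next
  case False
  hence "char_speed w y * (z - y) \<le> 0" using assms by (simp add: mult_nonpos_nonneg)
  thus ?thesis using curve_flux_below_tangent[of y z w] assms by simp
qed

section \<open>The wave patterns of the classical solver\<close>

lemma rarefaction_state_char_speed:
  assumes "0 \<le> a" "a \<le> \<rho>" "\<rho> \<le> b"
  shows "rarefaction_state p w a b (char_speed w \<rho>) = (\<rho>, w - p \<rho>)"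
  unfolding rarefaction_state_def using assms
  by (intro the_equality) (auto simp: lambda1_curve char_speed_eq_iff)

text \<open>
  The rarefaction fan together with the two constant states next to it is one continuous function:
  the inverse of the strictly decreasing characteristic speed, extended by constants. The traces at
  \<open>0\<close> then need no case distinction on the position of the fan.
\<close>

lemma fan_density:
  assumes "0 \<le> a" "a \<le> b"
  obtains R where "continuous_on UNIV R" "\<And>x. a \<le> R x" "\<And>x. R x \<le> b"
    "\<And>x. x \<le> char_speed w b \<Longrightarrow> R x = b" "\<And>x. char_speed w a \<le> x \<Longrightarrow> R x = a"
    "\<And>x. char_speed w b \<le> x \<Longrightarrow> x \<le> char_speed w a \<Longrightarrow> char_speed w (R x) = x"
proof -
  let ?S = "char_speed w"
  define J where "J = the_inv_into {a..b} ?S"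
  have inj: "inj_on ?S {a..b}" using assms by (auto intro!: inj_onI simp: char_speed_eq_iff)
  have cont: "continuous_on {a..b} ?S" using assms by (intro continuous_on_subset[OF char_speed_cont]) auto
  have le: "?S b \<le> ?S a" using assms by (simp add: char_speed_le_iff)
  have img: "?S ` {a..b} = {?S b..?S a}"
  proof (intro equalityI subsetI)
    fix x assume "x \<in> {?S b..?S a}"
    thus "x \<in> ?S ` {a..b}" using IVT2'[of ?S b x a] assms cont by force
  qed (use assms in \<open>auto simp: char_speed_le_iff\<close>)
  have J: "J x \<in> {a..b} \<and> ?S (J x) = x" if "x \<in> {?S b..?S a}" for x
    using the_inv_into_into[OF inj _ subset_refl] f_the_inv_into_f[OF inj] that
    unfolding J_def img by blast
  have JS: "J (?S \<rho>) = \<rho>" if "\<rho> \<in> {a..b}" for \<rho>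
    unfolding J_def using the_inv_into_f_f[OF inj that] .
  have contJ: "continuous_on {?S b..?S a} J"
    using continuous_on_inv[OF cont, of J] JS by (simp add: img)
  define c where "c x = max (?S b) (min x (?S a))" for x
  have c: "c x \<in> {?S b..?S a}" for x using le by (auto simp: c_def)
  have "continuous_on UNIV (\<lambda>x. J (c x))"
  proof (rule continuous_on_compose2[OF contJ])
    show "continuous_on UNIV c" unfolding c_def by (intro continuous_intros)
  qed (use c in auto)
  moreover have "a \<le> J (c x)" "J (c x) \<le> b" for x using J[OF c[of x]] by auto
  moreover have "J (c x) = b" if "x \<le> ?S b" for x using that le assms JS[of b] by (auto simp: c_def max_def min_def)
  moreover have "J (c x) = a" if "?S a \<le> x" for x using that le assms JS[of a] by (auto simp: c_def max_def min_def)
  moreover have "?S (J (c x)) = x" if "?S b \<le> x" "x \<le> ?S a" for x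
    using J[of x] that by (auto simp: c_def)
  ultimately show ?thesis by (rule that)
qed

text \<open>Used for the trace at \<open>0\<close> when the first wave is a fan.\<close>

lemma curve_cont:
  assumes "continuous_on UNIV R" "\<And>x. 0 \<le> R x"
  shows "isCont (\<lambda>x. (R x, w - p (R x))) y"
proof -
  have "continuous_on UNIV (\<lambda>x. p (R x))"
    by (rule continuous_on_compose2[OF p_cont assms(1)]) (use assms in auto)
  hence "continuous_on UNIV (\<lambda>x. (R x, w - p (R x)))"
    using assms by (intro continuous_intros)
  thus ?thesis by (simp add: continuous_on_eq_continuous_at)
qed

lemma Greatest_I2:
  assumes "0 \<le> \<rho>m"
  shows "(GREATEST \<rho>. \<rho> \<in> I2 p (\<rho>l, w - p \<rho>l) (\<rho>r, w - p \<rho>m)) = \<rho>m"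
  using assms by (intro Greatest_equality) (auto simp: I2_def p_eq_iff)

lemma RS_contact:
  assumes "0 \<le> \<rho>l"
  shows "RS p (\<rho>l, w - p \<rho>l) (\<rho>r, w - p \<rho>l) x
    = (if x < w - p \<rho>l then (\<rho>l, w - p \<rho>l) else (\<rho>r, w - p \<rho>l))"
  using Greatest_I2[OF assms, of \<rho>l w \<rho>r] by (simp add: RS_def)

text \<open>
  As \<open>\<rho>m * vm\<close> and \<open>\<rho>l * vl\<close> are both values of the curve flux, the shock speed is a chord slope of it.
\<close>

lemma RS_shock:
  assumes "0 \<le> \<rho>l" "\<rho>l < \<rho>m"
    and "\<sigma> = (curve_flux w \<rho>m - curve_flux w \<rho>l) / (\<rho>m - \<rho>l)"
  shows "RS p (\<rho>l, w - p \<rho>l) (\<rho>r, w - p \<rho>m) x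
    = (if x < \<sigma> then (\<rho>l, w - p \<rho>l) else if x < w - p \<rho>m then (\<rho>m, w - p \<rho>m) else (\<rho>r, w - p \<rho>m))"
  using Greatest_I2[of \<rho>m \<rho>l w \<rho>r] assms p_strict_mono[of \<rho>l \<rho>m]
  by (simp add: RS_def curve_flux_def)

text \<open>
  For \<open>\<rho>m = 0\<close> the fan reaches up to \<open>x = vr\<close> inclusively, hence the disjunction in the last clause.
\<close>

lemma RS_rarefaction:
  assumes "0 \<le> \<rho>m" "\<rho>m < \<rho>l"
  obtains R where "continuous_on UNIV R" "\<And>x. \<rho>m \<le> R x"
    "\<And>x. x \<le> char_speed w \<rho>l \<Longrightarrow> R x = \<rho>l"
    "\<And>x. char_speed w \<rho>l \<le> x \<Longrightarrow> x \<le> char_speed w \<rho>m \<Longrightarrow> char_speed w (R x) = x"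
    "\<And>x. RS p (\<rho>l, w - p \<rho>l) (\<rho>r, w - p \<rho>m) x
       = (if x < w - p \<rho>m \<or> x \<le> char_speed w \<rho>m then (R x, w - p (R x)) else (\<rho>r, w - p \<rho>m))"
proof -
  obtain R where R: "continuous_on UNIV R" "\<And>x. \<rho>m \<le> R x" "\<And>x. R x \<le> \<rho>l"
    "\<And>x. x \<le> char_speed w \<rho>l \<Longrightarrow> R x = \<rho>l" "\<And>x. char_speed w \<rho>m \<le> x \<Longrightarrow> R x = \<rho>m"
    "\<And>x. char_speed w \<rho>l \<le> x \<Longrightarrow> x \<le> char_speed w \<rho>m \<Longrightarrow> char_speed w (R x) = x"
    using fan_density[of \<rho>m \<rho>l w] assms by auto
  have fan: "rarefaction_state p w \<rho>m \<rho>l x = (R x, w - p (R x))"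
    if "char_speed w \<rho>l \<le> x" "x \<le> char_speed w \<rho>m" for x
    using rarefaction_state_char_speed[of \<rho>m "R x" \<rho>l w] R(2,3,6) that assms by simp
  have "char_speed w \<rho>l < char_speed w \<rho>m" using assms by (rule char_speed_less)
  hence "RS p (\<rho>l, w - p \<rho>l) (\<rho>r, w - p \<rho>m) x
       = (if x < w - p \<rho>m \<or> x \<le> char_speed w \<rho>m then (R x, w - p (R x)) else (\<rho>r, w - p \<rho>m))" for x
    using Greatest_I2[OF assms(1), of \<rho>l w \<rho>r] assms p_strict_mono[of \<rho>m \<rho>l] p_nonneg[of \<rho>m] R(4,5)[of x] fan[of x]
    by (auto simp: RS_def lambda1_curve)
  thus ?thesis using that R by blast
qed

lemma RS_vacuum:
  assumes "0 \<le> \<rho>l" "w < vr"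
  obtains R where "continuous_on UNIV R" "\<And>x. 0 \<le> R x"
    "\<And>x. x \<le> char_speed w \<rho>l \<Longrightarrow> R x = \<rho>l"
    "\<And>x. RS p (\<rho>l, w - p \<rho>l) (\<rho>r, vr) x
       = (if x \<le> w then (R x, w - p (R x)) else if x < vr then (0, x) else (\<rho>r, vr))"
proof -
  have S0: "char_speed w 0 = w" by (simp add: char_speed_def p_0)
  obtain R where R: "continuous_on UNIV R" "\<And>x. 0 \<le> R x" "\<And>x. R x \<le> \<rho>l"
    "\<And>x. x \<le> char_speed w \<rho>l \<Longrightarrow> R x = \<rho>l" "\<And>x. char_speed w 0 \<le> x \<Longrightarrow> R x = 0"
    "\<And>x. char_speed w \<rho>l \<le> x \<Longrightarrow> x \<le> char_speed w 0 \<Longrightarrow> char_speed w (R x) = x"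
    using fan_density[of 0 \<rho>l w] assms by auto
  have fan: "rarefaction_state p w 0 \<rho>l x = (R x, w - p (R x))"
    if "char_speed w \<rho>l \<le> x" "x \<le> w" for x
    using rarefaction_state_char_speed[of 0 "R x" \<rho>l w] R(2,3,6) S0 that by simp
  have "char_speed w \<rho>l \<le> w" using char_speed_le[of \<rho>l w] p_nonneg[of \<rho>l] assms by linarith
  hence "RS p (\<rho>l, w - p \<rho>l) (\<rho>r, vr) x
       = (if x \<le> w then (R x, w - p (R x)) else if x < vr then (0, x) else (\<rho>r, vr))" for x
    using assms p_nonneg[of \<rho>l] R(4)[of x] fan[of x]
    by (auto simp: RS_def lambda1_curve)
  thus ?thesis using that R by blast
qed

section \<open>Comparison of the constrained solutions\<close>

text \<open>
  What an active constraint says about the classical solution. With \<open>vr = 0\<close> no car passes \<open>x = 0\<close>.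
  For \<open>vr > 0\<close> the contact is to the right of \<open>0\<close>, so the flux there is that of a state of the curve.
  In a fan its density is at least \<open>\<rho>m\<close>; across a shock the flux selected at \<open>0\<close> is the smaller one
  of the two sides, so \<open>\<rho>m\<close> has flux above \<open>q\<close> as well. The disjunction of these two facts is
  what later excludes a wave of negative speed.
\<close>

lemma trace_flux:
  assumes "0 \<le> \<rho>l" "p \<rho>l \<le> w" "0 \<le> vr" "0 < q"
    and q: "q < flux_at_0 (RS p (\<rho>l, w - p \<rho>l) (\<rho>r, vr))"
    and m: "vr \<le> w \<longrightarrow> 0 \<le> \<rho>m \<and> w - p \<rho>m = vr"
  shows "0 < vr \<and> (\<exists>\<rho>0\<ge>0. q < curve_flux w \<rho>0 \<and> (vr \<le> w \<longrightarrow> q < curve_flux w \<rho>m \<or> \<rho>m \<le> \<rho>0))"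
proof (cases "vr \<le> w")
  case False
  then obtain R where R: "continuous_on UNIV R" "\<And>x. 0 \<le> R x"
     "\<And>x. x \<le> char_speed w \<rho>l \<Longrightarrow> R x = \<rho>l"
    "\<And>x. RS p (\<rho>l, w - p \<rho>l) (\<rho>r, vr) x
       = (if x \<le> w then (R x, w - p (R x)) else if x < vr then (0, x) else (\<rho>r, vr))"
    using RS_vacuum[of \<rho>l w vr \<rho>r] assms by (metis not_le)
  have "0 < vr" using False p_nonneg[of \<rho>l] assms by linarith
  show ?thesis
  proof (cases "w = 0")
    case True
    have "\<rho>l = 0" using assms(1,2) True p_nonneg[of \<rho>l] p_eq_iff[of \<rho>l 0] p_0 by simp
    hence R0: "R x = 0" if "x \<le> 0" for x using R(3)[of x] that True by (simp add: char_speed_def p_0)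
    \<comment> \<open>The case \<open>\<rho>l = vl = 0\<close>: both traces at \<open>0\<close> are the state \<open>(0, 0)\<close>.\<close>
    define u where "u = RS p (\<rho>l, w - p \<rho>l) (\<rho>r, vr)"
    have u: "u x = (0, 0)" if "x \<le> 0" for x
      using R(4)[of x] R0[OF that] that True by (simp add: u_def p_0)
    have u': "u x = (0, x)" if "0 < x" "x < vr" for x
      using R(4)[of x] that True by (simp add: u_def)
    have "flux_at_0 u = flux (0, 0)"
    proof (rule flux_at_0_eq[OF _ _ refl refl])
      show "(u \<longlongrightarrow> (0, 0)) (at_left 0)"
        by (rule tendsto_eventually) (auto simp: eventually_at_left[of "-1"] u intro!: exI[of _ "-1"])
      have "((\<lambda>x. (0 :: real, x :: real)) \<longlongrightarrow> (0, 0)) (at_right 0)"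
        by (intro tendsto_intros)
      thus "(u \<longlongrightarrow> (0, 0)) (at_right 0)"
        by (rule Lim_transform_eventually)
           (use \<open>0 < vr\<close> in \<open>auto simp: eventually_at_right[of _ vr] u'\<close>)
    qed
    thus ?thesis using q \<open>0 < q\<close> by (simp add: flux_def u_def)
  next
    case w: False
    have "flux_at_0 (RS p (\<rho>l, w - p \<rho>l) (\<rho>r, vr)) = flux (R 0, w - p (R 0))"
      by (rule flux_at_0_continuous[of w, OF _ _ curve_cont[OF R(1,2)]])
         (use w assms(2) p_nonneg[OF assms(1)] R(4) in auto)
    thus ?thesis using q R(2)[of 0] \<open>0 < vr\<close> False by (auto simp: flux_def curve_flux_def)
  qed
next
  case True
  with m have m: "0 \<le> \<rho>m" "vr = w - p \<rho>m" by auto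
  show ?thesis
  proof (cases "\<rho>m < \<rho>l")
    case True
    have "0 < vr" using p_strict_mono[OF m(1) True] assms m by linarith
    obtain R where R: "continuous_on UNIV R" "\<And>x. \<rho>m \<le> R x"
      "\<And>x. RS p (\<rho>l, w - p \<rho>l) (\<rho>r, vr) x
       = (if x < w - p \<rho>m \<or> x \<le> char_speed w \<rho>m then (R x, w - p (R x)) else (\<rho>r, w - p \<rho>m))"
      using RS_rarefaction[OF m(1) True, of w \<rho>r] m(2) by metis
    have R0: "0 \<le> R x" for x using R(2)[of x] m by simp
    have "flux_at_0 (RS p (\<rho>l, w - p \<rho>l) (\<rho>r, vr)) = flux (R 0, w - p (R 0))"
      by (rule flux_at_0_continuous[of vr, OF _ _ curve_cont[OF R(1) R0]])
         (use \<open>0 < vr\<close> m R(3) in auto)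
    thus ?thesis using q R(2)[of 0] R0 \<open>0 < vr\<close> by (auto simp: flux_def curve_flux_def)
  next
    case False
    let ?u = "RS p (\<rho>l, w - p \<rho>l) (\<rho>r, vr)" and ?l = "(\<rho>l, w - p \<rho>l)" and ?m = "(\<rho>m, w - p \<rho>m)"
    have fl: "flux ?l = curve_flux w \<rho>l" "flux ?m = curve_flux w \<rho>m"
      by (auto simp: flux_def curve_flux_def)
    show ?thesis
    proof (cases "\<rho>m = \<rho>l")
      case eq: True
      have u: "?u x = (if x < vr then ?l else (\<rho>r, vr))" for x
        using RS_contact[OF assms(1), of w \<rho>r x] m eq by simp
      have "flux_at_0 ?u = flux ?l"
      proof (cases "vr = 0")
        case True
        show ?thesis
          by (rule flux_at_0_jump[of "-1" 1]) (use True u m eq in \<open>auto simp: flux_def\<close>)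
      next
        case False
        thus ?thesis
          by (intro flux_at_0_jump[of "-1" vr]) (use u assms in auto)
      qed
      moreover have "vr \<noteq> 0" using q assms m eq calculation by (auto simp: flux_def)
      ultimately show ?thesis using q fl eq assms by auto
    next
      case neq: False
      hence less: "\<rho>l < \<rho>m" using False by simp
      define \<sigma> where "\<sigma> = (curve_flux w \<rho>m - curve_flux w \<rho>l) / (\<rho>m - \<rho>l)"
      have u: "?u x = (if x < \<sigma> then ?l else if x < vr then ?m else (\<rho>r, vr))" for x
        using RS_shock[OF assms(1) less \<sigma>_def, of \<rho>r x] m by simp
      have \<sigma>: "curve_flux w \<rho>m = curve_flux w \<rho>l + \<sigma> * (\<rho>m - \<rho>l)" using less by (simp add: \<sigma>_def)
      have Gl: "0 \<le> curve_flux w \<rho>l" using assms by (simp add: curve_flux_def)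
      have Gm: "curve_flux w \<rho>m = \<rho>m * vr" using m by (simp add: curve_flux_def)
      \<comment> \<open>For \<open>vr = 0\<close> the contact stands at \<open>0\<close>; the shock is not to its right.\<close>
      have nonpos: "\<sigma> \<le> 0" if "vr = 0"
      proof -
        have "\<sigma> * (\<rho>m - \<rho>l) \<le> 0" using \<sigma> Gm Gl that by simp
        thus ?thesis using less by (simp add: mult_le_0_iff)
      qed
      have eq0: "curve_flux w \<rho>m = curve_flux w \<rho>l" if "\<sigma> = 0" using \<sigma> that by simp
      have y: "vr \<noteq> 0 \<and> (flux_at_0 ?u = curve_flux w \<rho>m \<or> 0 < \<sigma> \<and> flux_at_0 ?u = curve_flux w \<rho>l)"
      proof (cases "vr = 0")
        case True
        have "flux_at_0 ?u = flux (if \<sigma> < 0 then ?m else ?l)"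
        proof (rule flux_at_0_jump[of "if \<sigma> < 0 then \<sigma> else -1" 1])
          show "flux (if \<sigma> < 0 then ?m else ?l) = flux (\<rho>r, vr)"
            using fl Gm eq0 nonpos True by (auto simp: flux_def)
        qed (use True u nonpos in \<open>auto split: if_splits\<close>)
        also have "\<dots> = 0" using fl Gm eq0 nonpos True by auto
        finally show ?thesis using q assms by simp
      next
        case False
        hence pos: "0 < vr" using assms by simp
        consider "\<sigma> < 0" | "\<sigma> = 0" | "0 < \<sigma>" by linarith
        thus ?thesis
        proof cases
          case 1
          have "flux_at_0 ?u = flux ?m"
            by (rule flux_at_0_jump[of \<sigma> vr]) (use 1 u pos in auto)
          thus ?thesis using fl False by simp
        next
          case 2
          have "flux_at_0 ?u = flux ?l"
            by (rule flux_at_0_jump[of "-1" vr _ _ ?m]) (use 2 u pos eq0 fl in auto)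
          thus ?thesis using fl False 2 eq0 by simp
        next
          case 3
          have "flux_at_0 ?u = flux ?l"
            by (rule flux_at_0_jump[of "-1" \<sigma>]) (use 3 u in auto)
          thus ?thesis using fl False 3 by simp
        qed
      qed
      have "0 < \<sigma> \<Longrightarrow> curve_flux w \<rho>l < curve_flux w \<rho>m" using \<sigma> less by simp
      hence "q < curve_flux w \<rho>m" using y q by auto
      thus ?thesis using y assms m by auto
    qed
  qed
qed

text \<open>
  A root of \<open>G = q\<close> below \<open>\<rho>0\<close> exists because \<open>G 0 < q < G \<rho>0\<close>. By concavity no smaller one exists,
  and \<open>G\<close> increases there, so that waves of the first family that start at this root move to the
  right at first.
\<close>

lemma check_state1_eq:
  assumes "0 < q" "0 \<le> \<rho>0" "q < curve_flux w \<rho>0"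
  obtains \<rho>1 where "0 < \<rho>1" "\<rho>1 < \<rho>0" "curve_flux w \<rho>1 = q" "0 < char_speed w \<rho>1"
    "\<And>\<rho>l. check_state1 p q (\<rho>l, w - p \<rho>l) = (\<rho>1, w - p \<rho>1)"
proof -
  have "continuous_on {0..\<rho>0} (curve_flux w)" by (rule continuous_on_subset[OF curve_flux_cont]) auto
  then obtain \<rho>1 where r1: "0 \<le> \<rho>1" "\<rho>1 \<le> \<rho>0" "curve_flux w \<rho>1 = q"
    using IVT'[of "curve_flux w" 0 q \<rho>0] assms by (auto simp: curve_flux_def)
  have pos: "0 < \<rho>1" using r1 assms by (cases "\<rho>1 = 0") (auto simp: curve_flux_def)
  have less: "\<rho>1 < \<rho>0" using r1 assms by (cases "\<rho>1 = \<rho>0") auto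
  have "0 < char_speed w \<rho>1 * (\<rho>0 - \<rho>1)"
    using curve_flux_below_tangent[of \<rho>1 \<rho>0 w] r1 less assms by simp
  hence speed: "0 < char_speed w \<rho>1" using less by (simp add: zero_less_mult_iff)
  have "check_state1 p q (\<rho>l, w - p \<rho>l) = (\<rho>1, w - p \<rho>1)" for \<rho>l
  proof -
    have "(LEAST \<rho>. \<rho> \<in> I1 p q (\<rho>l, w - p \<rho>l)) = \<rho>1"
    proof (rule Least_equality)
      show "\<rho>1 \<in> I1 p q (\<rho>l, w - p \<rho>l)" using r1 by (simp add: I1_def curve_flux_def)
      fix y assume "y \<in> I1 p q (\<rho>l, w - p \<rho>l)"
      hence "0 \<le> y" "curve_flux w y = q" by (auto simp: I1_def curve_flux_def)
      thus "\<rho>1 \<le> y" using curve_flux_gt_min[of y \<rho>1 \<rho>0 w] less r1 assms by (cases "y < \<rho>1") auto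
    qed
    moreover have "q / \<rho>1 = w - p \<rho>1" using r1 pos by (auto simp: curve_flux_def field_simps)
    ultimately show ?thesis by (simp add: check_state1_def)
  qed
  thus ?thesis using that pos less r1 speed by blast
qed

text \<open>
  Write \<open>v1 = w - p \<rho>1\<close>, so that \<open>\<rho>1 * v1 = q\<close>. If \<open>v1 < vr\<close> (fan or vacuum), then \<open>q / vr < \<rho>1\<close>, and
  the density decreases from \<open>\<rho>1\<close> below \<open>q / vr\<close>, since \<open>\<rho>m * vr = G \<rho>m < q\<close>. If \<open>v1 > vr\<close> (shock),
  then \<open>\<rho>1 < q / vr \<le> \<rho>m\<close>, and the shock speed is in \<open>[0, vr)\<close>.
  If \<open>v1 = vr\<close>, the density is \<open>q / vr = \<rho>1\<close> up to \<open>x = vr\<close>.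
\<close>

lemma RS1_straddles_check_density:
  fixes w vr \<rho>1 \<rho>m \<rho>r q :: real
  assumes r1: "0 < \<rho>1" "curve_flux w \<rho>1 = q" "0 < char_speed w \<rho>1" and q: "0 < q" and vr: "0 < vr"
    and m: "vr \<le> w \<longrightarrow> 0 \<le> \<rho>m \<and> w - p \<rho>m = vr"
    and flux_m: "vr \<le> w \<longrightarrow> \<rho>1 < \<rho>m \<longrightarrow> q \<le> curve_flux w \<rho>m"
  defines "u \<equiv> (\<lambda>x. fst (RS p (\<rho>1, w - p \<rho>1) (\<rho>r, vr) x))"
  shows "\<And>x. vr < x \<Longrightarrow> u x = \<rho>r"
    and "\<exists>a b. 0 \<le> a \<and> a < b \<and> b \<le> vr \<and> (\<forall>x. a < x \<and> x < b \<longrightarrow> q / vr \<le> u x)"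
    and "\<exists>a b. 0 \<le> a \<and> a < b \<and> b \<le> vr \<and> (\<forall>x. a < x \<and> x < b \<longrightarrow> u x \<le> q / vr)"
proof -
  have v1: "\<rho>1 * (w - p \<rho>1) = q" using r1 by (simp add: curve_flux_def)
  have c_le: "q / vr \<le> \<rho>1" if "w - p \<rho>1 \<le> vr"
    using mult_left_mono[OF that, of \<rho>1] r1 vr v1 by (simp add: field_simps)
  have le_c: "\<rho>1 \<le> q / vr" if "vr \<le> w - p \<rho>1"
    using mult_left_mono[OF that, of \<rho>1] r1 vr v1 by (simp add: field_simps)
  have speed1: "char_speed w \<rho>1 \<le> w - p \<rho>1" using char_speed_le[of \<rho>1 w] r1 by simp
  have "(\<forall>x. vr < x \<longrightarrow> u x = \<rho>r)
      \<and> (\<exists>a b. 0 \<le> a \<and> a < b \<and> b \<le> vr \<and> (\<forall>x. a < x \<and> x < b \<longrightarrow> q / vr \<le> u x))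
      \<and> (\<exists>a b. 0 \<le> a \<and> a < b \<and> b \<le> vr \<and> (\<forall>x. a < x \<and> x < b \<longrightarrow> u x \<le> q / vr))"
  proof (cases "vr \<le> w")
    case False
    have "w - p \<rho>1 \<le> w" using p_nonneg[of \<rho>1] r1 by simp
    hence ineq: "char_speed w \<rho>1 \<le> w" "0 < w" "w < vr" "w - p \<rho>1 \<le> vr"
      using speed1 r1 False by linarith+
    obtain R where R: "\<And>x. x \<le> char_speed w \<rho>1 \<Longrightarrow> R x = \<rho>1"
      "\<And>x. RS p (\<rho>1, w - p \<rho>1) (\<rho>r, vr) x
       = (if x \<le> w then (R x, w - p (R x)) else if x < vr then (0, x) else (\<rho>r, vr))"
      using RS_vacuum[of \<rho>1 w vr \<rho>r] r1 False by (metis not_le less_imp_le)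
    show ?thesis
    proof (intro conjI)
      show "\<exists>a b. 0 \<le> a \<and> a < b \<and> b \<le> vr \<and> (\<forall>x. a < x \<and> x < b \<longrightarrow> q / vr \<le> u x)"
        using r1 ineq R(1) c_le by (intro exI[of _ 0] exI[of _ "char_speed w \<rho>1"]) (auto simp: u_def R(2))
      show "\<exists>a b. 0 \<le> a \<and> a < b \<and> b \<le> vr \<and> (\<forall>x. a < x \<and> x < b \<longrightarrow> u x \<le> q / vr)"
        using q vr ineq by (intro exI[of _ w] exI[of _ vr]) (auto simp: u_def R(2))
    qed (use ineq in \<open>auto simp: u_def R(2)\<close>)
  next
    case True
    with m have m: "0 \<le> \<rho>m" "vr = w - p \<rho>m" by auto
    have Gm: "curve_flux w \<rho>m = \<rho>m * vr" using m by (simp add: curve_flux_def)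
    consider "\<rho>m < \<rho>1" | "\<rho>m = \<rho>1" | "\<rho>1 < \<rho>m" by linarith
    thus ?thesis
    proof cases
      case 1
      obtain R where R: "\<And>x. \<rho>m \<le> R x" "\<And>x. x \<le> char_speed w \<rho>1 \<Longrightarrow> R x = \<rho>1"
        "\<And>x. char_speed w \<rho>1 \<le> x \<Longrightarrow> x \<le> char_speed w \<rho>m \<Longrightarrow> char_speed w (R x) = x"
        "\<And>x. RS p (\<rho>1, w - p \<rho>1) (\<rho>r, vr) x
         = (if x < w - p \<rho>m \<or> x \<le> char_speed w \<rho>m then (R x, w - p (R x)) else (\<rho>r, w - p \<rho>m))"
        using RS_rarefaction[OF m(1) 1, of w \<rho>r] m(2) by metis
      have u: "u x = (if x < vr \<or> x \<le> char_speed w \<rho>m then R x else \<rho>r)" for x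
        using R(4)[of x] m(2) by (simp add: u_def)
      have vless: "w - p \<rho>1 < vr" using p_strict_mono[OF m(1) 1] m by simp
      have speed_m: "char_speed w \<rho>m \<le> vr" using char_speed_le[OF m(1), of w] m by simp
      \<comment> \<open>To the left of \<open>\<rho>1\<close> the concave flux stays below \<open>q\<close>, as it increases at \<open>\<rho>1\<close>.\<close>
      have "char_speed w \<rho>1 * (\<rho>m - \<rho>1) < 0" using r1 1 by (simp add: mult_less_0_iff)
      hence "\<rho>m * vr < q" using curve_flux_below_tangent[of \<rho>1 \<rho>m w] r1 m 1 Gm by simp
      hence c: "\<rho>m < q / vr" "q / vr \<le> \<rho>1" using vr vless c_le by (auto simp: field_simps)
      have speed_c: "char_speed w \<rho>1 \<le> char_speed w (q / vr)" "char_speed w (q / vr) < char_speed w \<rho>m"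
        using c r1 m by (auto simp: char_speed_le_iff intro: char_speed_less)
      show ?thesis
      proof (intro conjI)
        show "\<exists>a b. 0 \<le> a \<and> a < b \<and> b \<le> vr \<and> (\<forall>x. a < x \<and> x < b \<longrightarrow> q / vr \<le> u x)"
          using r1 vless speed1 R(2) c by (intro exI[of _ 0] exI[of _ "char_speed w \<rho>1"]) (auto simp: u)
        \<comment> \<open>The part of the fan beyond the characteristic of density \<open>q / vr\<close>. A constant state
          \<open>\<rho>m\<close> need not be visible: it has an empty interval for \<open>\<rho>m = 0\<close>.\<close>
        have "u x \<le> q / vr" if "char_speed w (q / vr) < x" "x < char_speed w \<rho>m" for x
        proof -
          have "char_speed w (R x) = x" using R(3)[of x] that speed_c by simp
          hence "R x \<le> q / vr" using char_speed_le_iff[of "q / vr" "R x" w] that R(1)[of x] m q vr by simp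
          thus ?thesis using that by (simp add: u)
        qed
        thus "\<exists>a b. 0 \<le> a \<and> a < b \<and> b \<le> vr \<and> (\<forall>x. a < x \<and> x < b \<longrightarrow> u x \<le> q / vr)"
          using speed_c speed_m r1 by (intro exI[of _ "char_speed w (q / vr)"] exI[of _ "char_speed w \<rho>m"]) auto
      qed (use speed_m in \<open>auto simp: u\<close>)
    next
      case 2
      have u: "u x = (if x < vr then \<rho>1 else \<rho>r)" for x
        using RS_contact[of \<rho>1 w \<rho>r x] m 2 by (simp add: u_def)
      have "q / vr = \<rho>1" using c_le le_c m 2 by simp
      hence "0 \<le> (0::real) \<and> 0 < vr \<and> vr \<le> vr \<and> (\<forall>x. 0 < x \<and> x < vr \<longrightarrow> u x = q / vr)"
        using vr by (simp add: u)
      moreover have "\<forall>x. vr < x \<longrightarrow> u x = \<rho>r" by (simp add: u)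
      ultimately show ?thesis by (metis order_refl)
    next
      case 3
      define \<sigma> where "\<sigma> = (curve_flux w \<rho>m - curve_flux w \<rho>1) / (\<rho>m - \<rho>1)"
      have u: "u x = (if x < \<sigma> then \<rho>1 else if x < vr then \<rho>m else \<rho>r)" for x
        using RS_shock[OF _ 3 \<sigma>_def, of \<rho>r x] r1 m by (simp add: u_def)
      have vless: "vr < w - p \<rho>1" using p_strict_mono[OF _ 3] m r1 by simp
      have "\<rho>1 * vr < q" using mult_strict_left_mono[OF vless, of \<rho>1] r1 v1 by simp
      hence \<sigma>: "0 \<le> \<sigma>" "\<sigma> < vr"
        using 3 flux_m True r1 Gm by (auto simp: \<sigma>_def field_simps)
      have c: "q / vr \<le> \<rho>m" "\<rho>1 \<le> q / vr" using flux_m[rule_format, OF True 3] Gm vr le_c vless by (auto simp: field_simps)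
      \<comment> \<open>A standing shock hides \<open>\<rho>1\<close>, but then \<open>\<rho>m\<close> is itself the plateau value.\<close>
      have c0: "\<rho>m = q / vr" if "\<sigma> = 0" using that 3 r1 Gm vr by (auto simp: \<sigma>_def field_simps)
      show ?thesis
      proof (intro conjI)
        show "\<exists>a b. 0 \<le> a \<and> a < b \<and> b \<le> vr \<and> (\<forall>x. a < x \<and> x < b \<longrightarrow> q / vr \<le> u x)"
          using \<sigma> c by (intro exI[of _ \<sigma>] exI[of _ vr]) (auto simp: u)
        show "\<exists>a b. 0 \<le> a \<and> a < b \<and> b \<le> vr \<and> (\<forall>x. a < x \<and> x < b \<longrightarrow> u x \<le> q / vr)"
          using \<sigma> c c0 by (intro exI[of _ 0] exI[of _ "if \<sigma> = 0 then vr else \<sigma>"]) (auto simp: u)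
      qed (use \<sigma> in \<open>auto simp: u\<close>)
    qed
  qed
  thus "\<And>x. vr < x \<Longrightarrow> u x = \<rho>r"
    "\<exists>a b. 0 \<le> a \<and> a < b \<and> b \<le> vr \<and> (\<forall>x. a < x \<and> x < b \<longrightarrow> q / vr \<le> u x)"
    "\<exists>a b. 0 \<le> a \<and> a < b \<and> b \<le> vr \<and> (\<forall>x. a < x \<and> x < b \<longrightarrow> u x \<le> q / vr)"
    by blast+
qed

lemma tot_var_RS2_le_RS1:
  assumes q: "q > 0" and l: "(\<rho>l, vl) \<in> states" and r: "(\<rho>r, vr) \<in> states"
    and RS: "RS_defined p (\<rho>l, vl) (\<rho>r, vr)"
  shows "tot_var (\<lambda>x. fst (RS2 p q (\<rho>l, vl) (\<rho>r, vr) x))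
       \<le> tot_var (\<lambda>x. fst (RS1 p q (\<rho>l, vl) (\<rho>r, vr) x))"
proof (cases "flux_at_0 (RS p (\<rho>l, vl) (\<rho>r, vr)) \<le> q")
  case True
  thus ?thesis by (simp add: RS1_def RS2_def constrained_RS_def)
next
  case False
  define w where "w = vl + p \<rho>l"
  have vl: "vl = w - p \<rho>l" by (simp add: w_def)
  have nonneg: "0 \<le> \<rho>l" "p \<rho>l \<le> w" "0 \<le> vr" using l r by (auto simp: states_def w_def)
  obtain \<rho>m where m: "vr \<le> w \<longrightarrow> 0 \<le> \<rho>m \<and> w - p \<rho>m = vr"
    using RS by (force simp: RS_defined_def I2_def w_def)
  obtain \<rho>0 where vr: "0 < vr" and r0: "0 \<le> \<rho>0" "q < curve_flux w \<rho>0"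
      "vr \<le> w \<longrightarrow> q < curve_flux w \<rho>m \<or> \<rho>m \<le> \<rho>0"
    using trace_flux[OF nonneg q _ m, of \<rho>r] False vl by auto
  obtain \<rho>1 where r1: "0 < \<rho>1" "\<rho>1 < \<rho>0" "curve_flux w \<rho>1 = q" "0 < char_speed w \<rho>1"
    and check1: "check_state1 p q (\<rho>l, vl) = (\<rho>1, w - p \<rho>1)"
    using check_state1_eq[OF q r0(1,2)] vl by metis
  \<comment> \<open>If \<open>\<rho>1 < \<rho>m < \<rho>0\<close>, concavity keeps the flux at \<open>\<rho>m\<close> above \<open>q\<close>.\<close>
  have "vr \<le> w \<longrightarrow> \<rho>1 < \<rho>m \<longrightarrow> q \<le> curve_flux w \<rho>m"
    using r0 r1 curve_flux_gt_min[of \<rho>1 \<rho>m \<rho>0 w] by (cases "\<rho>m = \<rho>0") force+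
  note after = RS1_straddles_check_density[OF r1(1,3,4) q vr m this, where \<rho>r = \<rho>r]
  have check2: "RS p (check_state2 q (\<rho>r, vr)) (\<rho>r, vr) x = (if x < vr then (q / vr, vr) else (\<rho>r, vr))" for x
    using RS_contact[of "q / vr" "vr + p (q / vr)" \<rho>r x] q vr by (simp add: check_state2_def)
  obtain a1 b1 where above: "0 \<le> a1" "a1 < b1" "b1 \<le> vr"
      "\<And>x. a1 < x \<Longrightarrow> x < b1 \<Longrightarrow> q / vr \<le> fst (RS p (\<rho>1, w - p \<rho>1) (\<rho>r, vr) x)"
    using after(2) by auto
  obtain a2 b2 where below: "0 \<le> a2" "a2 < b2" "b2 \<le> vr"
      "\<And>x. a2 < x \<Longrightarrow> x < b2 \<Longrightarrow> fst (RS p (\<rho>1, w - p \<rho>1) (\<rho>r, vr) x) \<le> q / vr"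
    using after(3) by auto
  have u1: "fst (RS1 p q (\<rho>l, vl) (\<rho>r, vr) x)
      = (if x < 0 then fst (RS p (\<rho>l, vl) (hat_state p q (\<rho>l, vl)) x)
         else fst (RS p (\<rho>1, w - p \<rho>1) (\<rho>r, vr) x))" for x
    using False by (simp add: RS1_def constrained_RS_def check1)
  have u2: "fst (RS2 p q (\<rho>l, vl) (\<rho>r, vr) x)
      = (if x < 0 then fst (RS p (\<rho>l, vl) (hat_state p q (\<rho>l, vl)) x)
         else if x < vr then q / vr else \<rho>r)" for x
    using False check2[of x] by (simp add: RS2_def constrained_RS_def)
  show ?thesis
  proof (rule tot_var_le_if_intermediate_plateau)
    show "a1 < b1" "b1 \<le> vr" "a2 < b2" "b2 \<le> vr" "0 \<le> a1" "0 \<le> a2" by fact+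
    show "fst (RS1 p q (\<rho>l, vl) (\<rho>r, vr) x) = \<rho>r" if "vr < x" for x
      unfolding u1 using after(1)[OF that] that vr by simp
    show "q / vr \<le> fst (RS1 p q (\<rho>l, vl) (\<rho>r, vr) x)" if "a1 < x" "x < b1" for x
      unfolding u1 using above(4)[OF that] above(1) that by simp
    show "fst (RS1 p q (\<rho>l, vl) (\<rho>r, vr) x) \<le> q / vr" if "a2 < x" "x < b2" for x
      unfolding u1 using below(4)[OF that] below(1) that by simp
  qed (use vr in \<open>auto simp: u1 u2\<close>)
qed

end

theorem proposition4p1:
  fixes p :: "real \<Rightarrow> real" and q \<rho>l vl \<rho>r vr :: real
  assumes "is_pressure p"
    and "q > 0"
    and "(\<rho>l, vl) \<in> states" and "(\<rho>r, vr) \<in> states"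
    and "RS_defined p (\<rho>l, vl) (\<rho>r, vr)"
  shows "tot_var (\<lambda>x. fst (RS1 p q (\<rho>l, vl) (\<rho>r, vr) x))
       \<ge> tot_var (\<lambda>x. fst (RS2 p q (\<rho>l, vl) (\<rho>r, vr) x))"
proof -
  note pressure = assms(1)[unfolded is_pressure_def]
  from conjunct1[OF pressure] obtain p' p'' where
    d: "\<forall>\<rho>\<ge>0. (p has_real_derivative p' \<rho>) (at \<rho> within {0..})"
      "\<forall>\<rho>\<ge>0. (p' has_real_derivative p'' \<rho>) (at \<rho> within {0..})" "\<forall>\<rho>>0. p' \<rho> > 0"
    by (elim exE conjE) (rule that)
  from conjunct2[OF pressure] have p: "p 0 = 0" "strictly_convex_on {0..} (\<lambda>\<rho>. \<rho> * p \<rho>)"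
    by blast+
  have "continuous_on {0..} p'" by (rule DERIV_continuous_on) (use d(2) in auto)
  with d p interpret pressure p p'
    by unfold_locales auto
  show ?thesis using assms(2-5) by (rule tot_var_RS2_le_RS1)
qed

end
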